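(* Let $k, n_{\mathsf{A}}, \tau$ be positive integers with $k+2\le n_{\mathsf{A}}<2k$ and $1\le\tau\le n_{\mathsf{A}}-k-1$. Every $(n_{\mathsf{A}},k)$ Class $\mathsf{A}$ code over $\mathbb{F}_{q^p}$ with $\tau$ piggybacks per row can correct at least $n_{\mathsf{A}}-k-\tau+1$ node failures; that is, for any set of at most $n_{\mathsf{A}}-k-\tau+1$ of the $n_{\mathsf{A}}$ nodes (data or parity nodes), if all symbols stored in these nodes are erased, the whole data array is uniquely determined by the symbols stored in the remaining nodes.
   Context: $\mathbb{F}_{q^p}$ denotes the finite field of order $q^p$ ($q$ prime, $p\ge 1$), and $(a)_k$ denotes $a \bmod k\in\{0,\ldots,k-1\}$. Data: there are $k$ data (systematic) nodes, numbered $j=0,\ldots,k-1$, each storing $k$ data symbols in $\mathbb{F}_{q^p}$; $d_{i,j}$ ($i,j=0,\ldots,k-1$) is the $i$th symbol in data node $j$. The data array is the $k\times k$ array with entries $d_{i,j}$; its entries are arbitrary elements of $\mathbb{F}_{q^p}$. $(n_{\mathsf{A}},k)$ Class $\mathsf{A}$ code with $\tau$ piggybacks per row: in addition to the $k$ data nodes there are $n_{\mathsf{A}}-k$ parity nodes, numbered $j=k,\ldots,n_{\mathsf{A}}-1$, each storing $k$ parity symbols $p^{\mathsf{A}}_{i,j}$, $i=0,\ldots,k-1$. They are built in two steps. Step 1. Fix a systematic $(n_{\mathsf{A}},k)$ maximum distance separable (MDS) linear code over $\mathbb{F}_{q^p}$ with parity coefficients $\alpha_{l,j}\in\mathbb{F}_{q^p}$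 ($l=0,\ldots,k-1$, $j=k,\ldots,n_{\mathsf{A}}-1$): a message $(x_0,\ldots,x_{k-1})$ is encoded as $(x_0,\ldots,x_{k-1},x_k,\ldots,x_{n_{\mathsf{A}}-1})$ with $x_j=\sum_{l=0}^{k-1}\alpha_{l,j}x_l$ for $j\ge k$, and any $k$ of the $n_{\mathsf{A}}$ coordinates determine the codeword. Encode each row of the data array with this same code, i.e. for $i=0,\ldots,k-1$ and $j=k,\ldots,n_{\mathsf{A}}-1$ form $$\sum_{l=0}^{k-1}\alpha_{l,j}\,d_{i,l}.$$ Step 2. Add piggybacks to the last $\tau$ parity nodes. The stored parity symbols are, for $i=0,\ldots,k-1$, $$p^{\mathsf{A}}_{i,j}=\sum_{l=0}^{k-1}\alpha_{l,j}\,d_{i,l}\quad\text{for } j=k,\ldots,n_{\mathsf{A}}-\tau-1,$$ $$p^{\mathsf{A}}_{i,u}=\sum_{l=0}^{k-1}\alpha_{l,u}\,d_{i,l}+d_{(i+u-n_{\mathsf{A}}+\tau+1)_k,\,i}\quad\text{for } u=n_{\mathsf{A}}-\tau,\ldots,n_{\mathsf{A}}-1.$$ The code thus has $n_{\mathsf{A}}$ nodes (columns), each storing $k$ symbols. A node failure is the erasure of all $k$ symbols stored in that node. *)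

theory Defs
  imports "HOL-Computational_Algebra.Primes" "HOL-Library.Cardinality"
begin

text \<open>
  Nodes are numbered from 0, and a data array is a function \<open>d\<close> with \<open>d i j\<close> the \<open>i\<close>-th symbol
  of data node \<open>j\<close>; only the entries with \<open>i < k\<close> and \<open>j < k\<close> are meaningful. Likewise only
  \<open>\<alpha> l j\<close> with \<open>l < k\<close> and \<open>j \<ge> k\<close> is ever used.
\<close>

definition sys_encode :: "nat \<Rightarrow> (nat \<Rightarrow> nat \<Rightarrow> 'a::field) \<Rightarrow> (nat \<Rightarrow> 'a) \<Rightarrow> nat \<Rightarrow> 'a" where
  "sys_encode k \<alpha> x j = (if j < k then x j else (\<Sum>l<k. \<alpha> l j * x l))"

definition systematic_mds :: "nat \<Rightarrow> nat \<Rightarrow> (nat \<Rightarrow> nat \<Rightarrow> 'a::field) \<Rightarrow> bool" where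
  "systematic_mds n k \<alpha> \<longleftrightarrow>
     (\<forall>S. S \<subseteq> {..<n} \<and> card S = k \<longrightarrow>
        (\<forall>x y. (\<forall>j\<in>S. sys_encode k \<alpha> x j = sys_encode k \<alpha> y j) \<longrightarrow>
               (\<forall>j<n. sys_encode k \<alpha> x j = sys_encode k \<alpha> y j)))"

text \<open>
  The \<open>i\<close>-th symbol stored in node \<open>j\<close>. In the piggybacked case \<open>j \<ge> n - \<tau>\<close>, so that
  \<open>j + \<tau> \<ge> n\<close> and the subtraction of \<open>n\<close> is not truncated.
\<close>

definition classA_symbol ::
  "nat \<Rightarrow> nat \<Rightarrow> nat \<Rightarrow> (nat \<Rightarrow> nat \<Rightarrow> 'a::field) \<Rightarrow> (nat \<Rightarrow> nat \<Rightarrow> 'a) \<Rightarrow> nat \<Rightarrow> nat \<Rightarrow> 'a" where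
  "classA_symbol n k \<tau> \<alpha> d i j =
     (if j < n - \<tau> then sys_encode k \<alpha> (d i) j
      else sys_encode k \<alpha> (d i) j + d ((i + j + \<tau> + 1 - n) mod k) i)"

definition corrects_node_failures ::
  "nat \<Rightarrow> nat \<Rightarrow> ((nat \<Rightarrow> nat \<Rightarrow> 'a) \<Rightarrow> nat \<Rightarrow> nat \<Rightarrow> 'a) \<Rightarrow> nat \<Rightarrow> bool" where
  "corrects_node_failures n k store t \<longleftrightarrow>
     (\<forall>E. E \<subseteq> {..<n} \<and> card E \<le> t \<longrightarrow>
        (\<forall>d d'. (\<forall>j\<in>{..<n} - E. \<forall>i<k. store d i j = store d' i j) \<longrightarrow>
                (\<forall>i<k. \<forall>j<k. d i j = d' i j)))"

end

theory Submission imports Defs begin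

text \<open>
  The first piggybacked node \<open>n - \<tau>\<close> stores in row \<open>i\<close> a codeword symbol of row \<open>i\<close> plus an entry
  of row \<open>i + 1\<close> (mod \<open>k\<close>). Among the nodes \<open>0, \<dots>, n - \<tau>\<close>, at least \<open>k\<close> survive. Hence once row
  \<open>i + 1\<close> is known, the piggyback can be removed and the MDS property recovers row \<open>i\<close>. The
  recursion starts at a row \<open>m\<close> whose data node \<open>m\<close> survives, as the piggyback in row \<open>m\<close> is a
  symbol of that node; such an \<open>m\<close> exists because fewer than \<open>k\<close> nodes fail. Going down cyclically
  from \<open>m\<close> recovers every row.
\<close>

text \<open>The MDS definition quantifies over sets of exactly \<open>k\<close> nodes, so
  \<open>S\<close> is first shrunk to such a set.\<close>

lemma systematic_mds_eqI:
  fixes \<alpha> :: "nat \<Rightarrow> nat \<Rightarrow> 'a::field"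
  assumes mds: "systematic_mds n k \<alpha>" and "k \<le> n" "S \<subseteq> {..<n}" "k \<le> card S"
    and eq: "\<And>j. j \<in> S \<Longrightarrow> sys_encode k \<alpha> x j = sys_encode k \<alpha> y j"
    and "j < k"
  shows "x j = y j"
proof -
  obtain T where "T \<subseteq> S" "card T = k"
    using \<open>k \<le> card S\<close> obtain_subset_with_card_n by metis
  then have "T \<subseteq> {..<n}" "\<forall>j\<in>T. sys_encode k \<alpha> x j = sys_encode k \<alpha> y j"
    using \<open>S \<subseteq> {..<n}\<close> eq by auto
  moreover have "j < n"
    using \<open>j < k\<close> \<open>k \<le> n\<close> by simp
  ultimately have "sys_encode k \<alpha> x j = sys_encode k \<alpha> y j"
    using mds \<open>card T = k\<close> unfolding systematic_mds_def by blast
  then show ?thesis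
    using \<open>j < k\<close> by (simp add: sys_encode_def)
qed

text \<open>Induction on the number \<open>r\<close> of cyclic successor steps that lead from
  \<open>i\<close> to \<open>m\<close>.\<close>

lemma cyclic_descent:
  fixes k m :: nat
  assumes "m < k" "P m" and step: "\<And>i. i < k \<Longrightarrow> P (Suc i mod k) \<Longrightarrow> P i"
    and "i < k"
  shows "P i"
proof -
  have reach: "P i" if "i < k" "(i + r) mod k = m" for i r
    using that
  proof (induction r arbitrary: i)
    case 0
    then show ?case using \<open>P m\<close> by simp
  next
    case (Suc r)
    have "(Suc i mod k + r) mod k = m"
      using Suc.prems by (simp add: mod_add_left_eq)
    moreover have "Suc i mod k < k"
      using \<open>m < k\<close> by simp
    ultimately show ?case
      using Suc.IH Suc.prems(1) step by blast
  qed
  \<comment> \<open>Going past \<open>k\<close> first avoids a case split on whether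
    \<open>i\<close> exceeds \<open>m\<close>; the sum is \<open>k + m\<close>.\<close>
  have "(i + (k - i + m)) mod k = m"
    using \<open>i < k\<close> \<open>m < k\<close> by simp
  then show ?thesis
    using reach \<open>i < k\<close> by blast
qed

lemma classA_corrects_node_failures:
  fixes \<alpha> :: "nat \<Rightarrow> nat \<Rightarrow> 'a::field"
  assumes mds: "systematic_mds n k \<alpha>" and "1 \<le> \<tau>" "k + \<tau> \<le> n" "n < 2 * k"
  shows "corrects_node_failures n k (classA_symbol n k \<tau> \<alpha>) (n - k - \<tau> + 1)"
  unfolding corrects_node_failures_def
proof (intro allI impI)
  fix E d d' i j
  assume E: "E \<subseteq> {..<n} \<and> card E \<le> n - k - \<tau> + 1"
    and agree: "\<forall>j\<in>{..<n} - E. \<forall>i<k. classA_symbol n k \<tau> \<alpha> d i j = classA_symbol n k \<tau> \<alpha> d' i j"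
    and "i < k" "j < k"
  have fin: "finite E"
    using E finite_subset by blast
  define S where "S = {..n - \<tau>} - E"
  have "n - \<tau> < n"
    using assms by linarith
  then have S: "S \<subseteq> {..<n}"
    unfolding S_def by auto
  have cardS: "k \<le> card S"
  proof -
    \<comment> \<open>The closed interval has \<open>n - \<tau> + 1\<close> nodes, and losing at
      most \<open>n - k - \<tau> + 1\<close> of them leaves \<open>k\<close>.\<close>
    have "Suc (n - \<tau>) - card E \<le> card S"
      using diff_card_le_card_Diff[OF fin, of "{..n - \<tau>}"] unfolding S_def by simp
    then show ?thesis
      using E assms by linarith
  qed
  have recover: "d r c = d' r c"
    if r: "r < k" and piggyback: "d (Suc r mod k) r = d' (Suc r mod k) r" and c: "c < k" for r c
  proof (rule systematic_mds_eqI[OF mds _ S cardS _ c])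
    show "k \<le> n"
      using assms by linarith
  next
    fix u assume "u \<in> S"
    then have "classA_symbol n k \<tau> \<alpha> d r u = classA_symbol n k \<tau> \<alpha> d' r u" "u \<le> n - \<tau>"
      using agree r S unfolding S_def by auto
    \<comment> \<open>At \<open>u = n - \<tau>\<close> the piggyback index
      \<open>r + u + \<tau> + 1 - n\<close> is \<open>Suc r\<close>; smaller \<open>u\<close> carry
      no piggyback.\<close>
    then show "sys_encode k \<alpha> (d r) u = sys_encode k \<alpha> (d' r) u"
      using piggyback \<open>k + \<tau> \<le> n\<close> by (cases "u = n - \<tau>") (simp_all add: classA_symbol_def)
  qed
  \<comment> \<open>Since \<tau> \<ge> 1 and n < 2k, at most n - k < k nodes fail.\<close>
  have "\<not> {..<k} \<subseteq> E"
    using card_mono[OF fin, of "{..<k}"] E assms by auto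
  then obtain m where m: "m < k" "m \<notin> E"
    by auto
  \<comment> \<open>As m < k \<le> n - \<tau>, node \<open>m\<close> stores its data symbols in the
    clear.\<close>
  have "d r m = d' r m" if "r < k" for r
  proof -
    have "m < n - \<tau>" "m \<in> {..<n} - E"
      using m assms by auto
    moreover from this have "classA_symbol n k \<tau> \<alpha> d r m = classA_symbol n k \<tau> \<alpha> d' r m"
      using agree that by blast
    ultimately show ?thesis
      using m by (simp add: classA_symbol_def sys_encode_def)
  qed
  moreover have "Suc m mod k < k"
    using m(1) by simp
  ultimately have base: "\<forall>c<k. d m c = d' m c"
    using recover[OF m(1)] by blast
  have "\<forall>c<k. d i c = d' i c"
  proof (rule cyclic_descent[where P = "\<lambda>r. \<forall>c<k. d r c = d' r c", OF m(1) base _ \<open>i < k\<close>])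
    fix r assume "r < k" "\<forall>c<k. d (Suc r mod k) c = d' (Suc r mod k) c"
    then show "\<forall>c<k. d r c = d' r c"
      using recover by blast
  qed
  then show "d i j = d' i j"
    using \<open>j < k\<close> by blast
qed

theorem theorem1:
  fixes k n\<^sub>A \<tau> q p :: nat
    and \<alpha> :: "nat \<Rightarrow> nat \<Rightarrow> 'a::{field,finite}"
  assumes "prime q" and "p \<ge> 1" and "CARD('a) = q ^ p"
    and "k > 0" and "n\<^sub>A > 0" and "\<tau> > 0"
    and "k + 2 \<le> n\<^sub>A" and "n\<^sub>A < 2 * k"
    and "1 \<le> \<tau>" and "\<tau> \<le> n\<^sub>A - k - 1"
    and "systematic_mds n\<^sub>A k \<alpha>"
  shows "corrects_node_failures n\<^sub>A k (classA_symbol n\<^sub>A k \<tau> \<alpha>) (n\<^sub>A - k - \<tau> + 1)"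
proof (rule classA_corrects_node_failures)
  show "k + \<tau> \<le> n\<^sub>A"
    using assms(7,10) by linarith
qed (use assms in simp_all)

end
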